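(* Let $(b,c)$ be a connected graph over the countably infinite set $X$. Then the following assertions are equivalent: (i) $(b,c)$ is uniformly transient. (ii) The harmonic boundary equals the Royden boundary: $\partial_hX=\partial_RX$.
   Context: $X$ is a countably infinite set, $C(X)$ the real-valued functions on $X$, $C_c(X)$ those with finite support, $\ell^\infty(X)$ the bounded ones, $\|f\|_\infty=\sup_X|f|$, and $C_0(X)$ is the closure of $C_c(X)$ with respect to $\|\cdot\|_\infty$. A graph $(b,c)$ over $X$ consists of a symmetric $b:X\times X\to[0,\infty)$ with zero diagonal and $\sum_{y}b(x,y)<\infty$ for all $x$, and an arbitrary $c:X\to[0,\infty)$. It is connected if for any two distinct $x,y\in X$ there are $x=x_0,\dots,x_n=y$ with $b(x_{i-1},x_i)>0$ for $i=1,\dots,n$. For $f\in C(X)$ put $\widetilde Q(f)=\frac12\sum_{x,y}b(x,y)|f(x)-f(y)|^2+\sum_x c(x)|f(x)|^2\in[0,\infty]$ and $\widetilde D=\{f\in C(X):\widetilde Q(f)<\infty\}$. For $o\in X$ put $\|f\|_o=(\widetilde Q(f)+|f(o)|^2)^{1/2}$; $\widetilde D_0$ is the closure of $C_c(X)$ in $\widetilde D$ with respect to $\|\cdot\|_o$ (independent of $o$ for connected graphs). A connected graph is uniformly transient if $\widetilde D_0\subseteq C_0(X)$. The Royden compactification $R$ of $(b,c)$ is the unique (up to homeomorphism) compact Hausdorff space such that $X$ (discrete) is a dense open subset of $R$, each function in the algebra $\widetilde D\cap\ell^\infty(X)$ extends uniquely to a continuous function on $R$, and (the extensions of) $\widetilde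 D\cap\ell^\infty(X)$ separate the points of $R$. Write $\hat f$ for the continuous extension of $f$ to $R$. The Royden boundary is $\partial_RX=R\setminus X$ and the harmonic boundary is $\partial_hX=\{x\in\partial_RX:\hat f(x)=0\text{ for all }f\in\widetilde D_0\cap\ell^\infty(X)\}$. *)

theory Defs
  imports "HOL-Analysis.Analysis"
begin

text \<open>The set \<open>X\<close> is the universe of a type \<open>'a\<close>, so that \<open>C(X)\<close> is the type \<open>'a \<Rightarrow> real\<close>.\<close>

definition is_graph :: "('a \<Rightarrow> 'a \<Rightarrow> real) \<Rightarrow> ('a \<Rightarrow> real) \<Rightarrow> bool" where
  "is_graph b c \<longleftrightarrow>
     (\<forall>x y. 0 \<le> b x y) \<and> (\<forall>x y. b x y = b y x) \<and> (\<forall>x. b x x = 0) \<and>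
     (\<forall>x. (\<lambda>y. b x y) summable_on UNIV) \<and> (\<forall>x. 0 \<le> c x)"

definition connected_graph :: "('a \<Rightarrow> 'a \<Rightarrow> real) \<Rightarrow> bool" where
  "connected_graph b \<longleftrightarrow>
     (\<forall>x y. x \<noteq> y \<longrightarrow>
       (\<exists>(n::nat) p. p 0 = x \<and> p n = y \<and> (\<forall>i\<in>{1..n}. 0 < b (p (i - 1)) (p i))))"

definition finsupp_funs :: "('a \<Rightarrow> real) set"  \<comment> \<open>\<open>C\<^sub>c(X)\<close>\<close> where
  "finsupp_funs = {f. finite {x. f x \<noteq> 0}}"

definition bounded_funs :: "('a \<Rightarrow> real) set"  \<comment> \<open>\<open>\<ell>\<^sup>\<infinity>(X)\<close>\<close> where
  "bounded_funs = {f. bounded (range f)}"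

text \<open>The supremum is taken in \<open>[0, \<infinity>]\<close>, so that it is meaningful for unbounded functions.\<close>

definition sup_norm :: "('a \<Rightarrow> real) \<Rightarrow> ennreal" where
  "sup_norm f = (SUP x. ennreal \<bar>f x\<bar>)"

definition C0_funs :: "('a \<Rightarrow> real) set" where
  "C0_funs = {f. \<forall>e>0. \<exists>g\<in>finsupp_funs. sup_norm (\<lambda>x. f x - g x) < ennreal e}"

definition energy :: "('a \<Rightarrow> 'a \<Rightarrow> real) \<Rightarrow> ('a \<Rightarrow> real) \<Rightarrow> ('a \<Rightarrow> real) \<Rightarrow> ennreal" where
  "energy b c f =
     ennreal (1/2) * (\<Sum>\<^sub>\<infinity>(x, y)\<in>UNIV. ennreal (b x y * \<bar>f x - f y\<bar>\<^sup>2)) +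
     (\<Sum>\<^sub>\<infinity>x\<in>UNIV. ennreal (c x * \<bar>f x\<bar>\<^sup>2))"

definition finite_energy :: "('a \<Rightarrow> 'a \<Rightarrow> real) \<Rightarrow> ('a \<Rightarrow> real) \<Rightarrow> ('a \<Rightarrow> real) set" where
  "finite_energy b c = {f. energy b c f < \<infinity>}"

text \<open>Used only for functions of finite energy; \<open>enn2real\<close> sends \<open>\<infinity>\<close> to \<open>0\<close>.\<close>

definition energy_norm ::
    "('a \<Rightarrow> 'a \<Rightarrow> real) \<Rightarrow> ('a \<Rightarrow> real) \<Rightarrow> 'a \<Rightarrow> ('a \<Rightarrow> real) \<Rightarrow> real" where
  "energy_norm b c r f = sqrt (enn2real (energy b c f) + \<bar>f r\<bar>\<^sup>2)"

text \<open>The space \<open>D\<^sub>0\<close> does not depend on the reference vertex \<open>r\<close> when the graph is connected.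
  The vertex is kept as a parameter here and in the notions derived from \<open>D\<^sub>0\<close>.\<close>

definition D0 ::
    "('a \<Rightarrow> 'a \<Rightarrow> real) \<Rightarrow> ('a \<Rightarrow> real) \<Rightarrow> 'a \<Rightarrow> ('a \<Rightarrow> real) set" where
  "D0 b c r = {f \<in> finite_energy b c.
     \<forall>e>0. \<exists>g\<in>finsupp_funs. energy_norm b c r (\<lambda>x. f x - g x) < e}"

definition uniformly_transient ::
    "('a \<Rightarrow> 'a \<Rightarrow> real) \<Rightarrow> ('a \<Rightarrow> real) \<Rightarrow> 'a \<Rightarrow> bool" where
  "uniformly_transient b c r \<longleftrightarrow> D0 b c r \<subseteq> C0_funs"

text \<open>A candidate compactification is a topology \<open>R\<close> with a map \<open>\<iota>\<close> from \<open>X\<close> into it.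
  Extensions are taken in \<open>extensional (topspace R)\<close> so that the unique extension is unique
  also as a total HOL function.\<close>

definition is_cont_extension ::
    "'r topology \<Rightarrow> ('a \<Rightarrow> 'r) \<Rightarrow> ('a \<Rightarrow> real) \<Rightarrow> ('r \<Rightarrow> real) \<Rightarrow> bool" where
  "is_cont_extension R \<iota> f g \<longleftrightarrow>
     g \<in> extensional (topspace R) \<and> continuous_map R euclideanreal g \<and> (\<forall>x. g (\<iota> x) = f x)"

definition cont_extension ::
    "'r topology \<Rightarrow> ('a \<Rightarrow> 'r) \<Rightarrow> ('a \<Rightarrow> real) \<Rightarrow> 'r \<Rightarrow> real" where
  "cont_extension R \<iota> f = (THE g. is_cont_extension R \<iota> f g)"

definition royden_compactification ::
    "('a \<Rightarrow> 'a \<Rightarrow> real) \<Rightarrow> ('a \<Rightarrow> real) \<Rightarrow> 'r topology \<Rightarrow> ('a \<Rightarrow> 'r) \<Rightarrow> bool" where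
  "royden_compactification b c R \<iota> \<longleftrightarrow>
     compact_space R \<and> Hausdorff_space R \<and>
     embedding_map (discrete_topology UNIV) R \<iota> \<and>
     openin R (range \<iota>) \<and> R closure_of (range \<iota>) = topspace R \<and>
     (\<forall>f \<in> finite_energy b c \<inter> bounded_funs. \<exists>!g. is_cont_extension R \<iota> f g) \<and>
     (\<forall>p \<in> topspace R. \<forall>q \<in> topspace R. p \<noteq> q \<longrightarrow>
        (\<exists>f \<in> finite_energy b c \<inter> bounded_funs.
           cont_extension R \<iota> f p \<noteq> cont_extension R \<iota> f q))"

definition royden_boundary :: "'r topology \<Rightarrow> ('a \<Rightarrow> 'r) \<Rightarrow> 'r set" where
  "royden_boundary R \<iota> = topspace R - range \<iota>"

definition harmonic_boundary ::
    "('a \<Rightarrow> 'a \<Rightarrow> real) \<Rightarrow> ('a \<Rightarrow> real) \<Rightarrow> 'a \<Rightarrow> 'r topology \<Rightarrow> ('a \<Rightarrow> 'r) \<Rightarrow> 'r set" where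
  "harmonic_boundary b c r R \<iota> =
     {p \<in> royden_boundary R \<iota>.
        \<forall>f \<in> D0 b c r \<inter> bounded_funs. cont_extension R \<iota> f p = 0}"

text \<open>Every graph has a Royden compactification, so that statements about an arbitrary one are
  not vacuous: take the closure of \<open>X\<close> in the product of compact intervals indexed by the bounded
  functions of finite energy.\<close>

lemma ennreal_infsum_le:
  fixes f :: "'b \<Rightarrow> ennreal"
  assumes "\<And>F. finite F \<Longrightarrow> sum f F \<le> B"
  shows "infsum f UNIV \<le> B"
  by (subst nonneg_infsum_complete) (auto intro!: SUP_least assms)

lemma indicator_finite_energy:
  fixes b :: "'a \<Rightarrow> 'a \<Rightarrow> real"
  assumes g: "is_graph b c"
  shows "indicator {x} \<in> finite_energy b c \<inter> bounded_funs"
proof -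
  let ?f = "indicator {x} :: 'a \<Rightarrow> real"
  have nn: "0 \<le> b y z" "0 \<le> c y" and sy: "b y z = b z y" and
    sm: "(\<lambda>y. b x y) summable_on UNIV" for y z
    using g by (auto simp: is_graph_def)
  define B where "B = infsum (b x) UNIV"
  have Bs: "(\<Sum>y\<in>G. b x y) \<le> B" if "finite G" for G
    unfolding B_def by (rule finite_sum_le_infsum) (use sm nn that in auto)
  have B0: "0 \<le> B" using Bs[of "{}"] by simp
  have "(\<Sum>\<^sub>\<infinity>(y, z)\<in>UNIV. ennreal (b y z * \<bar>?f y - ?f z\<bar>\<^sup>2)) \<le> ennreal (2 * B)"
  proof (rule ennreal_infsum_le)
    fix F :: "('a \<times> 'a) set" assume F: "finite F"
    define G where "G = fst ` F \<union> snd ` F"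
    have G: "finite G" "F \<subseteq> G \<times> G" using F by (force simp: G_def)+
    have "(\<Sum>(y, z)\<in>F. b y z * \<bar>?f y - ?f z\<bar>\<^sup>2) \<le> (\<Sum>(y, z)\<in>G\<times>G. b y z * \<bar>?f y - ?f z\<bar>\<^sup>2)"
      by (rule sum_mono2) (use G nn in auto)
    also have "\<dots> \<le> (\<Sum>(y, z)\<in>G\<times>G. (if y = x then b x z else 0) + (if z = x then b x y else 0))"
      by (rule sum_mono) (use nn sy in \<open>auto simp: indicator_def\<close>)
    also have "\<dots> = (\<Sum>y\<in>G. \<Sum>z\<in>G. if y = x then b x z else 0) +
        (\<Sum>y\<in>G. \<Sum>z\<in>G. if z = x then b x y else 0)"
      by (simp add: sum.cartesian_product[symmetric] sum.distrib)
    also have "(\<Sum>y\<in>G. \<Sum>z\<in>G. if y = x then b x z else 0)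
        = (\<Sum>z\<in>G. \<Sum>y\<in>G. if y = x then b x z else 0)"
      by (rule sum.swap)
    also have "\<dots> + (\<Sum>y\<in>G. \<Sum>z\<in>G. if z = x then b x y else 0)
        = (\<Sum>z\<in>G. if x \<in> G then b x z else 0) + (\<Sum>y\<in>G. if x \<in> G then b x y else 0)"
      using G by simp
    also have "\<dots> \<le> 2 * B" using Bs[OF G(1)] B0 by (cases "x \<in> G") auto
    finally have *: "(\<Sum>(y, z)\<in>F. b y z * \<bar>?f y - ?f z\<bar>\<^sup>2) \<le> 2 * B" .
    have "(\<Sum>(y, z)\<in>F. ennreal (b y z * \<bar>?f y - ?f z\<bar>\<^sup>2))
        = ennreal (\<Sum>(y, z)\<in>F. b y z * \<bar>?f y - ?f z\<bar>\<^sup>2)"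
      by (subst sum_ennreal[symmetric]) (use nn in \<open>auto simp: case_prod_unfold\<close>)
    then show "(\<Sum>(y, z)\<in>F. ennreal (b y z * \<bar>?f y - ?f z\<bar>\<^sup>2)) \<le> ennreal (2 * B)"
      using * by (simp add: ennreal_leI)
  qed
  then have 1: "(\<Sum>\<^sub>\<infinity>(y, z)\<in>UNIV. ennreal (b y z * \<bar>?f y - ?f z\<bar>\<^sup>2)) < \<infinity>"
    by (rule le_less_trans) simp
  have "(\<Sum>\<^sub>\<infinity>y\<in>UNIV. ennreal (c y * \<bar>?f y\<bar>\<^sup>2)) \<le> ennreal (c x)"
  proof (rule ennreal_infsum_le)
    fix F :: "'a set" assume F: "finite F"
    have "(\<Sum>y\<in>F. ennreal (c y * \<bar>?f y\<bar>\<^sup>2)) = (\<Sum>y\<in>F. if y = x then ennreal (c x) else 0)"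
      by (rule sum.cong) (auto simp: indicator_def)
    also have "\<dots> \<le> ennreal (c x)" using F by simp
    finally show "(\<Sum>y\<in>F. ennreal (c y * \<bar>?f y\<bar>\<^sup>2)) \<le> ennreal (c x)" .
  qed
  then have 2: "(\<Sum>\<^sub>\<infinity>y\<in>UNIV. ennreal (c y * \<bar>?f y\<bar>\<^sup>2)) < \<infinity>"
    by (rule le_less_trans) simp
  have "energy b c ?f < \<infinity>"
    unfolding energy_def using 1 2 by (simp add: ennreal_mult_less_top del: ennreal_half)
  moreover have "bounded (range ?f)"
    by (rule boundedI[where B=1]) (auto simp: indicator_def)
  ultimately show ?thesis by (simp add: finite_energy_def bounded_funs_def)
qed

lemma royden_compactification_exists:
  fixes b :: "'a \<Rightarrow> 'a \<Rightarrow> real"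
  assumes g: "is_graph b c"
  shows "\<exists>(R :: (('a \<Rightarrow> real) \<Rightarrow> real) topology) \<iota>. royden_compactification b c R \<iota>"
proof -
  define A where "A = finite_energy b c \<inter> bounded_funs"
  have ind: "indicator {x} \<in> A" for x
    using indicator_finite_energy[OF g] by (simp add: A_def)
  have "\<forall>f\<in>A. \<exists>M. \<forall>x. \<bar>f x\<bar> \<le> M"
    by (auto simp: A_def bounded_funs_def bounded_iff)
  then obtain M where M: "\<And>f x. f \<in> A \<Longrightarrow> \<bar>f x\<bar> \<le> M f" by metis
  define P where "P = product_topology (\<lambda>f. top_of_set {- M f..M f}) A"
  define e where "e = (\<lambda>x::'a. restrict (\<lambda>f. f x) A)"
  define R where "R = subtopology P (P closure_of range e)"
  have eP: "range e \<subseteq> topspace P"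
    using M by (force simp: P_def e_def abs_le_iff minus_le_iff)
  have tR: "topspace R = P closure_of range e"
    unfolding R_def by (rule topspace_subtopology_subset[OF closure_of_subset_topspace])
  have eR: "range e \<subseteq> topspace R"
    unfolding tR by (rule closure_of_subset[OF eP])
  have "compact_space P"
    unfolding P_def by (simp add: compact_space_product_topology compact_space_subtopology)
  then have cR: "compact_space R"
    unfolding R_def by (intro compact_space_subtopology closedin_compact_space) auto
  have "Hausdorff_space P"
    unfolding P_def Hausdorff_space_product_topology by (auto intro: Hausdorff_space_subtopology)
  then have hR: "Hausdorff_space R"
    unfolding R_def by (rule Hausdorff_space_subtopology)
  have dR: "R closure_of range e = topspace R"
    unfolding tR unfolding R_def
    by (simp add: closure_of_subtopology inf.absorb2[OF closure_of_subset[OF eP]])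
  have cont: "continuous_map R euclideanreal (\<lambda>p. p f)" if "f \<in> A" for f
  proof -
    have "continuous_map P (top_of_set {- M f..M f}) (\<lambda>p. p f)"
      unfolding P_def by (rule continuous_map_product_coordinates[OF that])
    then have "continuous_map P euclideanreal (\<lambda>p. p f)"
      by (simp add: continuous_map_in_subtopology)
    then show ?thesis unfolding R_def by (rule continuous_map_from_subtopology)
  qed
  have pt: "openin R {e x}" for x
  proof -
    define U where "U = {p \<in> topspace R. p (indicator {x}) \<in> {1/2<..}}"
    have U: "openin R U" unfolding U_def
      by (rule openin_continuous_map_preimage[OF cont[OF ind]]) (simp add: open_openin[symmetric])
    have exU: "e x \<in> U" using eR ind by (auto simp: U_def e_def)
    have "openin R (U - {e x})"
      using U hR eR by (intro openin_diff closedin_Hausdorff_singleton) auto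
    moreover have "(U - {e x}) \<inter> range e = {}"
      using ind[of x] by (auto simp: U_def e_def indicator_def of_bool_def split: if_splits)
    ultimately have "(U - {e x}) \<inter> topspace R = {}"
      using openin_Int_closure_of_eq_empty[of R "U - {e x}" "range e"] by (simp only: dR)
    then have "U - {e x} = {}" by (auto simp: U_def)
    then have "U = {e x}" using exU by blast
    then show ?thesis using U by simp
  qed
  have op: "openin R (e ` S)" for S
  proof -
    have "openin R (\<Union>x\<in>S. {e x})" by (rule openin_Union) (use pt in blast)
    then show ?thesis by (simp add: UNION_singleton_eq_range)
  qed
  have inj: "inj e"
  proof (rule injI)
    fix x y assume "e x = e y"
    then have "e x (indicator {x}) = e y (indicator {x})" by simp
    then show "x = y" using ind[of x] by (auto simp: e_def indicator_def split: if_splits)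
  qed
  have emb: "embedding_map (discrete_topology UNIV) R e"
    by (rule injective_open_imp_embedding_map)
      (use eR op inj in \<open>auto simp: open_map_def\<close>)
  have ext: "is_cont_extension R e f (restrict (\<lambda>p. p f) (topspace R))" if "f \<in> A" for f
    using cont[OF that] eR that
    by (auto simp: is_cont_extension_def e_def image_subset_iff intro: continuous_map_eq)
  have uniq: "g1 = g2" if "is_cont_extension R e f g1" "is_cont_extension R e f g2" for f g1 g2
  proof (rule extensionalityI[of _ "topspace R"])
    fix p assume "p \<in> topspace R"
    then have "p \<in> R closure_of range e" by (simp only: dR)
    then show "g1 p = g2 p"
      by (rule forall_in_closure_of_eq[where Y = euclideanreal])
        (use that in \<open>auto simp: is_cont_extension_def\<close>)
  qed (use that in \<open>auto simp: is_cont_extension_def\<close>)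
  have ce: "cont_extension R e f = restrict (\<lambda>p. p f) (topspace R)" if "f \<in> A" for f
    unfolding cont_extension_def 
    by (rule the_equality, rule ext[OF that]) (rule uniq[OF _ ext[OF that]])
  have "\<exists>f\<in>A. cont_extension R e f p \<noteq> cont_extension R e f q"
    if pq: "p \<in> topspace R" "q \<in> topspace R" "p \<noteq> q" for p q
  proof -
    have "p \<in> extensional A" "q \<in> extensional A"
      using pq closure_of_subset_topspace[of P "range e"]
      by (auto simp: tR P_def PiE_def)
    then obtain f where "f \<in> A" "p f \<noteq> q f"
      using pq(3) extensionalityI[of p A q] by blast
    then show ?thesis using pq ce by auto
  qed
  moreover have "\<exists>!g. is_cont_extension R e f g" if "f \<in> A" for f
    by (rule ex1I, rule ext[OF that]) (rule uniq[OF _ ext[OF that]])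
  ultimately have "royden_compactification b c R e"
    unfolding royden_compactification_def A_def[symmetric]
    by (intro conjI cR hR emb op dR ballI impI) simp_all
  then show ?thesis by blast
qed

end

theory Submission
  imports Defs
begin

text \<open>If \<open>f \<in> D\<^sub>0\<close> vanishes at infinity, its extension vanishes on the boundary: each
  neighbourhood of a boundary point meets \<open>X\<close> outside the finite set \<open>{\<bar>f\<bar> \<ge> e}\<close>.
  Conversely, let \<open>f \<in> D\<^sub>0\<close> and let \<open>g\<close> be \<open>f\<close> cut off at levels \<open>-1\<close> and \<open>1\<close>. Then \<open>g\<close>
  lies in \<open>D\<^sub>0\<close>: if \<open>\<phi> n \<rightarrow> f\<close> in the energy norm, the convergence is pointwise by connectedness,
  and the energy of the difference of the cut-offs tends to \<open>0\<close> by dominated convergence.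
  If the extension of \<open>g\<close> vanishes on the boundary, then for \<open>0 < e \<le> 1\<close> the set
  \<open>{\<bar>f\<bar> \<ge> e} = {\<bar>g\<bar> \<ge> e}\<close> is compact and contained in the discrete open set \<open>X\<close>, hence finite.\<close>

section \<open>Functions vanishing at infinity\<close>

text \<open>A finitely supported function closer to \<open>f\<close> than \<open>e\<close> is
  nonzero wherever \<open>e \<le> \<bar>f x\<bar>\<close>. Conversely, setting \<open>f\<close> to
  zero where it is small gives finitely supported approximants.\<close>

lemma C0_funs_iff:
  fixes f :: "'a \<Rightarrow> real"
  shows "f \<in> C0_funs \<longleftrightarrow> (\<forall>e>0. finite {x. e \<le> \<bar>f x\<bar>})"
proof
  assume f: "f \<in> C0_funs"
  show "\<forall>e>0. finite {x. e \<le> \<bar>f x\<bar>}"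
  proof (intro allI impI)
    fix e :: real assume e: "0 < e"
    then obtain g where g: "g \<in> finsupp_funs" "sup_norm (\<lambda>x. f x - g x) < ennreal e"
      using f by (auto simp: C0_funs_def)
    have lt: "\<bar>f x - g x\<bar> < e" for x
    proof -
      have "ennreal \<bar>f x - g x\<bar> \<le> sup_norm (\<lambda>x. f x - g x)"
        unfolding sup_norm_def by (rule SUP_upper) simp
      also have "\<dots> < ennreal e" by (rule g)
      finally show ?thesis by (simp add: ennreal_less_iff)
    qed
    have "{x. e \<le> \<bar>f x\<bar>} \<subseteq> {x. g x \<noteq> 0}"
      using lt by (smt (verit) Collect_mono)
    then show "finite {x. e \<le> \<bar>f x\<bar>}"
      using g(1) by (auto simp: finsupp_funs_def intro: finite_subset)
  qed
next
  assume fin: "\<forall>e>0. finite {x. e \<le> \<bar>f x\<bar>}"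
  show "f \<in> C0_funs"
    unfolding C0_funs_def
  proof (intro CollectI allI impI)
    fix e :: real assume e: "0 < e"
    \<comment> \<open>Pointwise bounds below \<open>e\<close> would only give a supremum of at most
      \<open>e\<close>; the threshold \<open>e / 2\<close> makes the inequality strict.\<close>
    define g where "g x = (if e / 2 \<le> \<bar>f x\<bar> then f x else 0)" for x
    have "{x. g x \<noteq> 0} \<subseteq> {x. e / 2 \<le> \<bar>f x\<bar>}" by (auto simp: g_def)
    moreover have "finite {x. e / 2 \<le> \<bar>f x\<bar>}" using fin e by (meson half_gt_zero)
    ultimately have "g \<in> finsupp_funs"
      unfolding finsupp_funs_def by (blast intro: finite_subset)
    moreover have "sup_norm (\<lambda>x. f x - g x) \<le> ennreal (e / 2)"
      unfolding sup_norm_def by (rule SUP_least, rule ennreal_leI) (use e in \<open>auto simp: g_def\<close>)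
    then have "sup_norm (\<lambda>x. f x - g x) < ennreal e"
      by (rule le_less_trans) (use e in \<open>simp add: ennreal_less_iff\<close>)
    ultimately show "\<exists>g\<in>finsupp_funs. sup_norm (\<lambda>x. f x - g x) < ennreal e" by blast
  qed
qed

section \<open>Nonnegative sums\<close>

text \<open>Both sides say that the finite partial sums are bounded. This moves energies from
  \<open>ennreal\<close> to real sums, where differences and limits can be handled.\<close>

lemma infsum_ennreal_finite_iff:
  fixes g :: "'i \<Rightarrow> real"
  assumes nn: "\<And>i. 0 \<le> g i"
  shows "(\<Sum>\<^sub>\<infinity>i. ennreal (g i)) < \<infinity> \<longleftrightarrow> g summable_on UNIV"
proof
  assume fin: "(\<Sum>\<^sub>\<infinity>i. ennreal (g i)) < \<infinity>"
  have "sum g F \<le> enn2real (\<Sum>\<^sub>\<infinity>i. ennreal (g i))" if "finite F" for F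
  proof -
    have "ennreal (sum g F) = (\<Sum>i\<in>F. ennreal (g i))" using nn by simp
    also have "\<dots> \<le> (\<Sum>\<^sub>\<infinity>i. ennreal (g i))"
      using that by (subst nonneg_infsum_complete) (auto intro!: SUP_upper)
    finally show ?thesis using fin nn
      by (metis enn2real_ennreal enn2real_mono sum_nonneg infinity_ennreal_def)
  qed
  then show "g summable_on UNIV"
    by (intro nonneg_bdd_above_summable_on) (auto intro!: bdd_aboveI2 nn)
next
  assume s: "g summable_on UNIV"
  have "(\<Sum>\<^sub>\<infinity>i. ennreal (g i)) \<le> ennreal (infsum g UNIV)"
  proof (rule ennreal_infsum_le)
    fix F :: "'i set" assume "finite F"
    then have "sum g F \<le> infsum g UNIV" by (intro finite_sum_le_infsum s) (auto intro: nn)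
    then show "(\<Sum>i\<in>F. ennreal (g i)) \<le> ennreal (infsum g UNIV)"
      using nn by (simp add: ennreal_leI)
  qed
  then show "(\<Sum>\<^sub>\<infinity>i. ennreal (g i)) < \<infinity>" by (rule le_less_trans) simp
qed

lemma infsum_ennreal:
  fixes g :: "'i \<Rightarrow> real"
  assumes nn: "\<And>i. 0 \<le> g i" and s: "g summable_on UNIV"
  shows "(\<Sum>\<^sub>\<infinity>i. ennreal (g i)) = ennreal (infsum g UNIV)"
proof -
  have "(\<Sum>\<^sub>\<infinity>i. ennreal (g i)) = (SUP F\<in>{F. finite F \<and> F \<subseteq> UNIV}. \<Sum>i\<in>F. ennreal (g i))"
    by (rule nonneg_infsum_complete) simp
  also have "\<dots> = ennreal (infsum g UNIV)"
    using nn by (subst infsum_nonneg_is_SUPREMUM_ennreal[OF s]) auto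
  finally show ?thesis .
qed

text \<open>Comparison via \<open>(h + k)\<^sup>2 \<le> 2 * h\<^sup>2 + 2 * k\<^sup>2\<close>. It
  serves both halves of the energy: weights \<open>b\<close> with differences along edges, and
  weights \<open>c\<close> with values.\<close>

lemma summable_on_weighted_square_add:
  fixes w h k :: "'i \<Rightarrow> real"
  assumes w: "\<And>i. 0 \<le> w i"
    and "(\<lambda>i. w i * (h i)\<^sup>2) summable_on A" "(\<lambda>i. w i * (k i)\<^sup>2) summable_on A"
  shows "(\<lambda>i. w i * (h i + k i)\<^sup>2) summable_on A"
proof (rule summable_on_comparison_test)
  show "(\<lambda>i. 2 * (w i * (h i)\<^sup>2) + 2 * (w i * (k i)\<^sup>2)) summable_on A"
    using assms(2,3) by (intro summable_on_add summable_on_cmult_right)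
  show "w i * (h i + k i)\<^sup>2 \<le> 2 * (w i * (h i)\<^sup>2) + 2 * (w i * (k i)\<^sup>2)" for i
  proof -
    have "(h i + k i)\<^sup>2 \<le> 2 * (h i)\<^sup>2 + 2 * (k i)\<^sup>2"
      using sum_squares_bound[of "h i" "k i"] by (simp add: power2_sum)
    from mult_left_mono[OF this w[of i]] show ?thesis by (simp add: algebra_simps)
  qed
qed (use w in auto)

text \<open>Dominated convergence for sums, where the bound may also contain terms that tend to \<open>0\<close>
  in mean.\<close>

lemma infsum_tendsto_0_dominated:
  fixes u v :: "nat \<Rightarrow> 'i \<Rightarrow> real" and w :: "'i \<Rightarrow> real"
  assumes u0: "\<And>n i. 0 \<le> u n i" and v0: "\<And>n i. 0 \<le> v n i"
    and le: "\<And>n i. u n i \<le> w i + v n i"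
    and w: "w summable_on UNIV" and v: "\<And>n. v n summable_on UNIV"
    and v_lim: "(\<lambda>n. infsum (v n) UNIV) \<longlonglongrightarrow> 0"
    and u_lim: "\<And>i. (\<lambda>n. u n i) \<longlonglongrightarrow> 0"
  shows "(\<lambda>n. infsum (u n) UNIV) \<longlonglongrightarrow> 0"
proof (rule order_tendstoI)
  fix e :: real assume e: "0 < e"
  \<comment> \<open>The finite set \<open>F\<close> leaves at most \<open>e / 2\<close> of the sum
    of \<open>w\<close> outside. On \<open>F\<close> the termwise limits suffice, and off
    \<open>F\<close> the bound by \<open>w\<close> and \<open>v n\<close> takes over.\<close>
  from infsum_finite_approximation[OF w, of "e / 2"] e
  obtain F where F: "finite F" "dist (sum w F) (infsum w UNIV) \<le> e / 2" by auto
  have wF: "w summable_on (- F)" and vF: "v n summable_on (- F)" for n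
    using w v by (blast intro: summable_on_subset_banach)+
  have u: "u n summable_on UNIV" for n
    by (rule summable_on_comparison_test[OF summable_on_add[OF w v[of n]]]) (use le u0 in auto)
  then have uF: "u n summable_on (- F)" for n by (blast intro: summable_on_subset_banach)
  have split: "infsum g UNIV = sum g F + infsum g (- F)" if "g summable_on UNIV" for g :: "'i \<Rightarrow> real"
    using infsum_Un_disjoint[of g F "- F"] that F(1)
    by (simp add: summable_on_subset_banach Compl_partition)
  have w_tail: "infsum w (- F) \<le> e / 2"
    using F(2) split[OF w] by (simp add: dist_real_def abs_if split: if_splits)
  have "infsum (u n) UNIV \<le> sum (u n) F + (e / 2 + infsum (v n) UNIV)" for n
  proof -
    have "infsum (u n) (- F) \<le> infsum (\<lambda>i. w i + v n i) (- F)"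
      by (intro infsum_mono uF summable_on_add wF vF le)
    also have "\<dots> = infsum w (- F) + infsum (v n) (- F)" by (rule infsum_add[OF wF vF])
    also have "infsum (v n) (- F) \<le> infsum (v n) UNIV"
      by (rule infsum_mono_neutral) (use v vF v0 in auto)
    finally show ?thesis using split[OF u] w_tail by simp
  qed
  moreover have "(\<lambda>n. sum (u n) F + (e / 2 + infsum (v n) UNIV)) \<longlonglongrightarrow> 0 + (e / 2 + 0)"
    by (intro tendsto_intros v_lim tendsto_null_sum u_lim)
  then have "\<forall>\<^sub>F n in sequentially. sum (u n) F + (e / 2 + infsum (v n) UNIV) < e"
    by (rule order_tendstoD) (use e in simp)
  ultimately show "\<forall>\<^sub>F n in sequentially. infsum (u n) UNIV < e"
    by (auto elim!: eventually_mono intro: le_less_trans)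
next
  fix e :: real assume "e < 0"
  then show "\<forall>\<^sub>F n in sequentially. e < infsum (u n) UNIV"
    by (intro always_eventually allI less_le_trans[OF _ infsum_nonneg]) (auto intro: u0)
qed

section \<open>Functions of finite energy\<close>

text \<open>Real-valued summand of the first sum in \<open>energy\<close>. It runs over ordered
  pairs, so each edge occurs twice; the factor \<open>1/2\<close> stays outside.\<close>

definition edge_energy :: "('a \<Rightarrow> 'a \<Rightarrow> real) \<Rightarrow> ('a \<Rightarrow> real) \<Rightarrow> 'a \<times> 'a \<Rightarrow> real" where
  "edge_energy b f = (\<lambda>(x, y). b x y * (f x - f y)\<^sup>2)"

definition kill_energy :: "('a \<Rightarrow> real) \<Rightarrow> ('a \<Rightarrow> real) \<Rightarrow> 'a \<Rightarrow> real" where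
  "kill_energy c f x = c x * (f x)\<^sup>2"

section \<open>The cut-off at levels -1 and 1\<close>

definition clamp1 :: "real \<Rightarrow> real" where
  "clamp1 t = max (- 1) (min 1 t)"

lemma clamp1_lipschitz: "\<bar>clamp1 s - clamp1 t\<bar> \<le> \<bar>s - t\<bar>"
  by (auto simp: clamp1_def max_def min_def)

lemma clamp1_0 [simp]: "clamp1 0 = 0"
  by (simp add: clamp1_def)

text \<open>Cutting off does not change the superlevel sets of \<open>\<bar>f\<bar>\<close> at
  levels up to 1, and these decide whether \<open>f\<close> vanishes at infinity.\<close>

lemma le_abs_clamp1_iff: "e \<le> 1 \<Longrightarrow> e \<le> \<bar>clamp1 t\<bar> \<longleftrightarrow> e \<le> \<bar>t\<bar>"
  by (auto simp: clamp1_def max_def min_def)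

context
  fixes b :: "'a \<Rightarrow> 'a \<Rightarrow> real" and c :: "'a \<Rightarrow> real"
  assumes graph: "is_graph b c"
begin

lemma edge_energy_nonneg: "0 \<le> edge_energy b f e"
  using graph by (auto simp: edge_energy_def is_graph_def split: prod.splits)

lemma kill_energy_nonneg: "0 \<le> kill_energy c f x"
  using graph by (auto simp: kill_energy_def is_graph_def)

lemma energy_eq:
  "energy b c f = ennreal (1/2) * (\<Sum>\<^sub>\<infinity>e. ennreal (edge_energy b f e)) +
    (\<Sum>\<^sub>\<infinity>x. ennreal (kill_energy c f x))"
  by (simp add: energy_def edge_energy_def kill_energy_def case_prod_unfold)

lemma finite_energy_iff:
  "f \<in> finite_energy b c \<longleftrightarrow> edge_energy b f summable_on UNIV \<and> kill_energy c f summable_on UNIV"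
proof -
  have "f \<in> finite_energy b c \<longleftrightarrow>
      (\<Sum>\<^sub>\<infinity>e. ennreal (edge_energy b f e)) < \<infinity> \<and> (\<Sum>\<^sub>\<infinity>x. ennreal (kill_energy c f x)) < \<infinity>"
    unfolding finite_energy_def energy_eq
    by (auto simp: ennreal_mult_less_top ennreal_add_less_top simp del: ennreal_half)
  then show ?thesis
    by (simp only: infsum_ennreal_finite_iff[OF edge_energy_nonneg]
        infsum_ennreal_finite_iff[OF kill_energy_nonneg])
qed

text \<open>Finiteness matters: at infinite energy \<open>enn2real\<close> returns 0, while one of
  the two real sums may still converge to a positive value.\<close>

lemma enn2real_energy:
  assumes "f \<in> finite_energy b c"
  shows "enn2real (energy b c f) =
    1/2 * infsum (edge_energy b f) UNIV + infsum (kill_energy c f) UNIV"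
proof -
  have s: "edge_energy b f summable_on UNIV" "kill_energy c f summable_on UNIV"
    using assms by (auto simp: finite_energy_iff)
  have "energy b c f =
      ennreal (1/2 * infsum (edge_energy b f) UNIV + infsum (kill_energy c f) UNIV)"
    unfolding energy_eq infsum_ennreal[OF edge_energy_nonneg s(1)]
      infsum_ennreal[OF kill_energy_nonneg s(2)]
    by (simp only: ennreal_mult[symmetric] ennreal_plus[symmetric] infsum_nonneg
        edge_energy_nonneg kill_energy_nonneg mult_nonneg_nonneg divide_nonneg_nonneg
        zero_le_one zero_le_numeral)
  then show ?thesis
    by (simp only:) (simp add: infsum_nonneg edge_energy_nonneg kill_energy_nonneg del: ennreal_plus)
qed

section \<open>Closure properties of the functions of finite energy\<close>

lemma finite_energy_add:
  assumes "f \<in> finite_energy b c" "g \<in> finite_energy b c"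
  shows "(\<lambda>x. f x + g x) \<in> finite_energy b c"
proof -
  have b: "0 \<le> case_prod b e" for e using graph by (auto simp: is_graph_def split: prod.splits)
  have c: "0 \<le> c x" for x using graph by (auto simp: is_graph_def)
  have "edge_energy b (\<lambda>x. f x + g x) summable_on UNIV"
    using summable_on_weighted_square_add[of "case_prod b" "\<lambda>(x, y). f x - f y" UNIV
        "\<lambda>(x, y). g x - g y"] b assms
    by (simp add: finite_energy_iff edge_energy_def case_prod_unfold algebra_simps)
  moreover have "kill_energy c (\<lambda>x. f x + g x) summable_on UNIV"
    using summable_on_weighted_square_add[of c f UNIV g] c assms
    by (simp add: finite_energy_iff kill_energy_def[abs_def])
  ultimately show ?thesis by (simp add: finite_energy_iff)
qed

lemma finite_energy_scale:
  assumes "f \<in> finite_energy b c"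
  shows "(\<lambda>x. t * f x) \<in> finite_energy b c"
proof -
  have "edge_energy b (\<lambda>x. t * f x) = (\<lambda>e. t\<^sup>2 * edge_energy b f e)"
    by (auto simp: edge_energy_def fun_eq_iff power2_eq_square algebra_simps)
  moreover have "kill_energy c (\<lambda>x. t * f x) = (\<lambda>x. t\<^sup>2 * kill_energy c f x)"
    by (auto simp: kill_energy_def fun_eq_iff power2_eq_square algebra_simps)
  ultimately show ?thesis
    using assms by (simp add: finite_energy_iff summable_on_cmult_right)
qed

lemma finite_energy_diff:
  assumes "f \<in> finite_energy b c" "g \<in> finite_energy b c"
  shows "(\<lambda>x. f x - g x) \<in> finite_energy b c"
  using finite_energy_add[OF assms(1) finite_energy_scale[OF assms(2), of "- 1"]] by simp

text \<open>Such a function is a finite linear combination of indicators of points, which have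
  finite energy because \<open>b x\<close> is summable.\<close>

lemma finite_energy_finsupp:
  assumes "f \<in> finsupp_funs"
  shows "f \<in> finite_energy b c"
proof -
  have zero: "(\<lambda>x. 0) \<in> finite_energy b c"
    by (simp add: finite_energy_iff edge_energy_def kill_energy_def[abs_def] case_prod_unfold)
  have "(\<lambda>x. \<Sum>a\<in>S. f a * indicator {a} x) \<in> finite_energy b c" if "finite S" for S
    using that
  proof (induction S)
    case (insert a S)
    have "(\<lambda>x. f a * indicator {a} x) \<in> finite_energy b c"
      using indicator_finite_energy[OF graph] finite_energy_scale by blast
    from finite_energy_add[OF this insert.IH] show ?case by (simp only: sum.insert[OF insert.hyps])
  qed (simp add: zero)
  from this[of "{y. f y \<noteq> 0}"]
  have "(\<lambda>x. \<Sum>a\<in>{y. f y \<noteq> 0}. f a * indicator {a} x) \<in> finite_energy b c"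
    using assms by (simp only: finsupp_funs_def mem_Collect_eq)
  moreover have "f = (\<lambda>x. \<Sum>a\<in>{y. f y \<noteq> 0}. f a * indicator {a} x)"
    using assms
    by (auto simp: fun_eq_iff finsupp_funs_def indicator_def of_bool_def if_distrib sum.If_cases
        cong: if_cong)
  ultimately show ?thesis by (simp only:)
qed

text \<open>\<open>clamp1\<close> is 1-Lipschitz and fixes 0, so no term of either energy sum
  increases.\<close>

lemma finite_energy_clamp1:
  assumes "f \<in> finite_energy b c"
  shows "(\<lambda>x. clamp1 (f x)) \<in> finite_energy b c"
proof -
  have nn: "0 \<le> b x y" "0 \<le> c x" for x y using graph by (auto simp: is_graph_def)
  have "edge_energy b (\<lambda>x. clamp1 (f x)) e \<le> edge_energy b f e" for e
    using clamp1_lipschitz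
    by (auto simp: edge_energy_def abs_le_square_iff split: prod.splits intro!: mult_left_mono nn)
  moreover have "kill_energy c (\<lambda>x. clamp1 (f x)) x \<le> kill_energy c f x" for x
    using clamp1_lipschitz[of "f x" 0]
    by (auto simp: kill_energy_def abs_le_square_iff intro!: mult_left_mono nn)
  ultimately show ?thesis
    using assms unfolding finite_energy_iff
    by (auto intro: summable_on_comparison_test edge_energy_nonneg kill_energy_nonneg)
qed

text \<open>A single edge term is at most the whole edge sum, so convergence to 0 passes from a
  vertex to each neighbour, and along a path from \<open>r\<close> to every vertex.\<close>

lemma pointwise_tendsto_0:
  assumes conn: "connected_graph b"
    and fin: "\<And>n. h n \<in> finite_energy b c"
    and edge: "(\<lambda>n. infsum (edge_energy b (h n)) UNIV) \<longlonglongrightarrow> 0"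
    and r: "(\<lambda>n. h n r) \<longlonglongrightarrow> 0"
  shows "(\<lambda>n. h n x) \<longlonglongrightarrow> 0"
proof (cases "x = r")
  case False
  have step: "(\<lambda>n. h n z) \<longlonglongrightarrow> 0" if y: "(\<lambda>n. h n y) \<longlonglongrightarrow> 0" and byz: "0 < b y z" for y z
  proof -
    \<comment> \<open>Finite energy is essential here, since \<open>infsum\<close> of a non-summable
      real family is 0.\<close>
    have "b y z * (h n y - h n z)\<^sup>2 \<le> infsum (edge_energy b (h n)) UNIV" for n
      using finite_sum_le_infsum[of "edge_energy b (h n)" UNIV "{(y, z)}"] fin[of n]
      by (simp add: finite_energy_iff edge_energy_nonneg) (simp add: edge_energy_def)
    then have "(\<lambda>n. b y z * (h n y - h n z)\<^sup>2) \<longlonglongrightarrow> 0"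
      by (intro tendsto_sandwich[OF _ _ tendsto_const edge]) (use byz in auto)
    then have "(\<lambda>n. (h n y - h n z)\<^sup>2) \<longlonglongrightarrow> 0"
      using byz by (subst (asm) tendsto_mult_left_iff[where c = "b y z" and l = 0, simplified]) auto
    then have "(\<lambda>n. h n y - h n z) \<longlonglongrightarrow> 0" by (simp add: power_tendsto_0_iff)
    from tendsto_diff[OF y this] show ?thesis by simp
  qed
  obtain m :: nat and p where p: "p 0 = r" "p m = x" "\<forall>i\<in>{1..m}. 0 < b (p (i - 1)) (p i)"
    using conn False unfolding connected_graph_def by metis
  have "(\<lambda>n. h n (p k)) \<longlonglongrightarrow> 0" if "k \<le> m" for k
    using that
  proof (induction k)
    case 0
    show ?case using r p(1) by simp
  next
    case (Suc k)
    have "0 < b (p k) (p (Suc k))" using p(3) Suc.prems by force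
    with Suc show ?case by (simp add: step[of "p k"])
  qed
  from this[of m] show ?thesis using p(2) by simp
qed (use r in simp)

text \<open>The cut-off is not linear, so the edge energy of a difference of cut-offs is not bounded
  by that of the difference. Hence dominated convergence for the edge part; the killing part depends
  on values only and is compared directly.\<close>

lemma D0_clamp1:
  assumes conn: "connected_graph b" and f: "f \<in> D0 b c r"
  shows "(\<lambda>x. clamp1 (f x)) \<in> D0 b c r"
proof -
  have f_fin: "f \<in> finite_energy b c" using f by (simp add: D0_def)
  \<comment> \<open>\<open>Suc n\<close> keeps the tolerance positive at \<open>n = 0\<close>, where
    \<open>1 / 0\<close> would be 0.\<close>
  have "\<forall>n. \<exists>g\<in>finsupp_funs. energy_norm b c r (\<lambda>x. f x - g x) < 1 / real (Suc n)"
    using f by (auto simp: D0_def)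
  then obtain \<phi> where \<phi>: "\<And>n. \<phi> n \<in> finsupp_funs"
    and \<phi>_less: "\<And>n. energy_norm b c r (\<lambda>x. f x - \<phi> n x) < 1 / real (Suc n)"
    by metis
  define h where "h n = (\<lambda>x. f x - \<phi> n x)" for n
  define k where "k n = (\<lambda>x. clamp1 (f x) - clamp1 (\<phi> n x))" for n
  have h: "h n \<in> finite_energy b c" for n
    unfolding h_def by (intro finite_energy_diff f_fin finite_energy_finsupp \<phi>)
  have k: "k n \<in> finite_energy b c" for n
    unfolding k_def
    by (intro finite_energy_diff finite_energy_clamp1 f_fin finite_energy_finsupp \<phi>)
  define N where "N n = energy_norm b c r (h n)" for n
  have "N \<longlonglongrightarrow> 0"
  proof (rule tendsto_sandwich[OF _ _ tendsto_const])
    show "(\<lambda>n. 1 / real (Suc n)) \<longlonglongrightarrow> 0"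
      using LIMSEQ_inverse_real_of_nat by (simp add: field_simps)
  qed (use \<phi>_less in \<open>auto simp: N_def h_def energy_norm_def intro!: always_eventually less_imp_le\<close>)
  then have N2: "(\<lambda>n. (N n)\<^sup>2) \<longlonglongrightarrow> 0" by (simp add: power_tendsto_0_iff)
  have nn: "0 \<le> infsum (edge_energy b g) UNIV" "0 \<le> infsum (kill_energy c g) UNIV" for g
    by (auto intro: infsum_nonneg edge_energy_nonneg kill_energy_nonneg)
  \<comment> \<open>Three nonnegative pieces: since the left side tends to 0, so does each of
    them.\<close>
  have N_eq: "(N n)\<^sup>2 = 1/2 * infsum (edge_energy b (h n)) UNIV +
      infsum (kill_energy c (h n)) UNIV + (h n r)\<^sup>2" for n
    using nn by (simp add: N_def energy_norm_def enn2real_energy[OF h])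
  have edge_h: "(\<lambda>n. infsum (edge_energy b (h n)) UNIV) \<longlonglongrightarrow> 0"
  proof (rule tendsto_sandwich[OF _ _ tendsto_const])
    show "(\<lambda>n. 2 * (N n)\<^sup>2) \<longlonglongrightarrow> 0" by (rule tendsto_mult_right_zero[OF N2])
  qed (use nn in \<open>auto simp: N_eq intro!: always_eventually add_nonneg_nonneg\<close>)
  have kill_h: "(\<lambda>n. infsum (kill_energy c (h n)) UNIV) \<longlonglongrightarrow> 0"
    by (rule tendsto_sandwich[OF _ _ tendsto_const N2])
      (use nn in \<open>auto simp: N_eq intro!: always_eventually add_nonneg_nonneg\<close>)
  have "(\<lambda>n. (h n r)\<^sup>2) \<longlonglongrightarrow> 0"
    by (rule tendsto_sandwich[OF _ _ tendsto_const N2])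
      (use nn in \<open>auto simp: N_eq intro!: always_eventually add_nonneg_nonneg\<close>)
  then have "(\<lambda>n. h n r) \<longlonglongrightarrow> 0" by (simp add: power_tendsto_0_iff)
  note h_lim = pointwise_tendsto_0[OF conn h edge_h this]
  have k_le_h: "\<bar>k n x\<bar> \<le> \<bar>h n x\<bar>" for n x
    unfolding k_def h_def by (rule clamp1_lipschitz)
  have k_lim: "(\<lambda>n. k n x) \<longlonglongrightarrow> 0" for x
    by (rule Lim_null_comparison[OF _ tendsto_rabs_zero[OF h_lim[of x]]]) (simp add: k_le_h)
  have b0: "0 \<le> b x y" and c0: "0 \<le> c x" for x y using graph by (auto simp: is_graph_def)
  have edge_k: "(\<lambda>n. infsum (edge_energy b (k n)) UNIV) \<longlonglongrightarrow> 0"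
  proof (rule infsum_tendsto_0_dominated)
    \<comment> \<open>With \<open>a\<close>, \<open>d\<close>, \<open>s\<close>, \<open>t\<close> as
      below, \<open>(a - d)\<^sup>2\<close> is at most \<open>2 * a\<^sup>2 + 2 * d\<^sup>2\<close>,
      hence at most \<open>2 * s\<^sup>2 + 2 * (s - t)\<^sup>2\<close>, and expanding the last
      square gives 6 and 4. The first term is the fixed summable bound, the second tends to 0 in
      mean.\<close>
    show "edge_energy b (k n) e \<le> 6 * edge_energy b f e + 4 * edge_energy b (h n) e" for n e
    proof (cases e)
      case (Pair x y)
      define s where "s = f x - f y"
      define t where "t = h n x - h n y"
      define a where "a = clamp1 (f x) - clamp1 (f y)"
      define d where "d = clamp1 (\<phi> n x) - clamp1 (\<phi> n y)"
      have "a\<^sup>2 \<le> s\<^sup>2" "d\<^sup>2 \<le> (s - t)\<^sup>2"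
        using clamp1_lipschitz[of "f x" "f y"] clamp1_lipschitz[of "\<phi> n x" "\<phi> n y"]
        by (auto simp: abs_le_square_iff a_def d_def s_def t_def h_def algebra_simps)
      moreover have "(a - d)\<^sup>2 \<le> 2 * a\<^sup>2 + 2 * d\<^sup>2" "(s - t)\<^sup>2 \<le> 2 * s\<^sup>2 + 2 * t\<^sup>2"
        \<comment> \<open>Parallelogram identity with the square of the sum dropped.\<close>
        using zero_le_power2[of "a + d"] zero_le_power2[of "s + t"]
        by (auto simp: power2_sum power2_diff)
      ultimately have "(a - d)\<^sup>2 \<le> 6 * s\<^sup>2 + 4 * t\<^sup>2" by linarith
      then have "b x y * (a - d)\<^sup>2 \<le> b x y * (6 * s\<^sup>2 + 4 * t\<^sup>2)"
        by (rule mult_left_mono[OF _ b0])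
      moreover have "edge_energy b (k n) e = b x y * (a - d)\<^sup>2"
        by (simp add: Pair edge_energy_def k_def a_def d_def algebra_simps)
      moreover have "6 * edge_energy b f e + 4 * edge_energy b (h n) e =
          b x y * (6 * s\<^sup>2 + 4 * t\<^sup>2)"
        by (simp add: Pair edge_energy_def s_def t_def algebra_simps)
      ultimately show ?thesis by (simp only:)
    qed
    show "(\<lambda>n. \<Sum>\<^sub>\<infinity>e. 4 * edge_energy b (h n) e) \<longlonglongrightarrow> 0"
      using tendsto_mult_right_zero[OF edge_h, of 4] by (simp add: infsum_cmult_right')
    show "(\<lambda>n. edge_energy b (k n) e) \<longlonglongrightarrow> 0" for e
    proof -
      have "(\<lambda>n. k n (fst e) - k n (snd e)) \<longlonglongrightarrow> 0"
        using tendsto_diff[OF k_lim k_lim] by simp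
      then show ?thesis
        unfolding edge_energy_def case_prod_unfold
        by (intro tendsto_mult_right_zero tendsto_null_power) simp_all
    qed
  qed (use f_fin h in \<open>auto simp: edge_energy_nonneg finite_energy_iff intro!: summable_on_cmult_right\<close>)
  have kill_k: "(\<lambda>n. infsum (kill_energy c (k n)) UNIV) \<longlonglongrightarrow> 0"
  proof (rule tendsto_sandwich[OF _ _ tendsto_const kill_h])
    have "infsum (kill_energy c (k n)) UNIV \<le> infsum (kill_energy c (h n)) UNIV" for n
      using h[of n] k[of n] k_le_h
      by (intro infsum_mono)
        (auto simp: finite_energy_iff kill_energy_def abs_le_square_iff intro!: mult_left_mono c0)
    then show "\<forall>\<^sub>F n in sequentially.
        infsum (kill_energy c (k n)) UNIV \<le> infsum (kill_energy c (h n)) UNIV"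
      by (intro always_eventually allI)
  qed (use nn in auto)
  have k_norm: "(\<lambda>n. energy_norm b c r (k n)) \<longlonglongrightarrow> 0"
    unfolding energy_norm_def enn2real_energy[OF k]
    by (auto intro!: tendsto_eq_intros edge_k kill_k k_lim)
  have supp: "(\<lambda>x. clamp1 (\<phi> n x)) \<in> finsupp_funs" for n
  proof -
    have "{x. clamp1 (\<phi> n x) \<noteq> 0} \<subseteq> {x. \<phi> n x \<noteq> 0}" by auto
    then show ?thesis
      using \<phi>[of n] by (simp add: finsupp_funs_def finite_subset)
  qed
  have "\<exists>g\<in>finsupp_funs. energy_norm b c r (\<lambda>x. clamp1 (f x) - g x) < e"
    if "0 < e" for e
  proof -
    have "\<forall>\<^sub>F n in sequentially. energy_norm b c r (k n) < e"
      by (rule order_tendstoD(2)[OF k_norm that])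
    then obtain n where "energy_norm b c r (k n) < e"
      using eventually_happens'[OF sequentially_bot] by blast
    then show ?thesis unfolding k_def by (rule bexI[OF _ supp])
  qed
  then show ?thesis
    using finite_energy_clamp1[OF f_fin] by (simp add: D0_def)
qed

end

section \<open>The Royden boundary\<close>

context
  fixes b :: "'a \<Rightarrow> 'a \<Rightarrow> real" and c :: "'a \<Rightarrow> real" and R :: "'r topology" and \<iota> :: "'a \<Rightarrow> 'r"
  assumes royden: "royden_compactification b c R \<iota>"
begin

lemma royden_embed_in_topspace: "\<iota> x \<in> topspace R"
  using royden by (auto simp: royden_compactification_def dest: openin_subset)

text \<open>Unique existence of the extension is part of \<open>royden_compactification\<close>, so
  the definite description in \<open>cont_extension\<close> denotes it.\<close>

lemma is_cont_extension_cont_extension: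
  assumes "f \<in> finite_energy b c \<inter> bounded_funs"
  shows "is_cont_extension R \<iota> f (cont_extension R \<iota> f)"
proof -
  have "\<exists>!g. is_cont_extension R \<iota> f g"
    using royden assms by (simp add: royden_compactification_def)
  then show ?thesis unfolding cont_extension_def by (rule theI')
qed

text \<open>The embedding of a discrete space makes points open in its range, and the range is open
  in \<open>R\<close>.\<close>

lemma openin_royden_singleton: "openin R {\<iota> x}"
proof -
  have "open_map (discrete_topology UNIV) (subtopology R (range \<iota>)) \<iota>"
    using royden
    by (simp add: royden_compactification_def embedding_map_def homeomorphic_imp_open_map)
  then have "openin (subtopology R (range \<iota>)) (\<iota> ` {x})"
    by (simp add: open_map_def del: image_insert)
  then show ?thesis
    using royden by (simp add: royden_compactification_def openin_open_subtopology)
qed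

text \<open>A nonzero value at \<open>p\<close> would yield a nonempty open set disjoint from the
  image of \<iota>, against density.\<close>

lemma cont_extension_eq_0_on_royden_boundary:
  assumes f: "f \<in> finite_energy b c \<inter> bounded_funs" "f \<in> C0_funs"
    and p: "p \<in> royden_boundary R \<iota>"
  shows "cont_extension R \<iota> f p = 0"
proof (rule ccontr)
  let ?g = "cont_extension R \<iota> f"
  assume ne: "?g p \<noteq> 0"
  have g: "continuous_map R euclideanreal ?g" "\<And>x. ?g (\<iota> x) = f x"
    using is_cont_extension_cont_extension[OF f(1)] by (auto simp: is_cont_extension_def)
  define e where "e = \<bar>?g p\<bar> / 2"
  have e: "0 < e" using ne by (simp add: e_def)
  \<comment> \<open>The removed set is finite, hence closed in the Hausdorff space \<open>R\<close>.
    It lies in the range of \<iota>, so the boundary point \<open>p\<close> survives, and what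
    remains contains no point of that range.\<close>
  define U where "U = {q \<in> topspace R. ?g q \<in> {t. e < \<bar>t\<bar>}} - \<iota> ` {x. e \<le> \<bar>f x\<bar>}"
  have "open {t::real. e < \<bar>t\<bar>}" by (intro open_Collect_less continuous_intros)
  then have "openin R {q \<in> topspace R. ?g q \<in> {t. e < \<bar>t\<bar>}}"
    using openin_continuous_map_preimage[OF g(1)] by (metis open_openin)
  moreover have "closedin R (\<iota> ` {x. e \<le> \<bar>f x\<bar>})"
    using royden f(2) e royden_embed_in_topspace
    by (intro closedin_Hausdorff_finite) (auto simp: royden_compactification_def C0_funs_iff)
  ultimately have "openin R U" unfolding U_def by (rule openin_diff)
  moreover have "U \<inter> range \<iota> = {}" by (auto simp: U_def g(2))
  ultimately have "U \<inter> topspace R = {}"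
    using openin_Int_closure_of_eq_empty[of R U "range \<iota>"] royden
    by (simp add: royden_compactification_def)
  moreover have "p \<in> U \<inter> topspace R"
    using p e by (auto simp: U_def royden_boundary_def e_def)
  ultimately show False by blast
qed

text \<open>A superlevel set of the extension is compact and, at a positive level, misses the
  boundary. Open singletons then cover it, so it is finite.\<close>

lemma C0_funs_if_cont_extension_eq_0:
  assumes f: "f \<in> finite_energy b c \<inter> bounded_funs"
    and zero: "\<And>p. p \<in> royden_boundary R \<iota> \<Longrightarrow> cont_extension R \<iota> f p = 0"
  shows "f \<in> C0_funs"
  unfolding C0_funs_iff
proof (intro allI impI)
  fix e :: real assume e: "0 < e"
  let ?g = "cont_extension R \<iota> f"
  have g: "continuous_map R euclideanreal ?g" "\<And>x. ?g (\<iota> x) = f x"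
    using is_cont_extension_cont_extension[OF f] by (auto simp: is_cont_extension_def)
  define K where "K = {q \<in> topspace R. ?g q \<in> {t. e \<le> \<bar>t\<bar>}}"
  have "closed {t::real. e \<le> \<bar>t\<bar>}" by (intro closed_Collect_le continuous_intros)
  then have "closedin R K"
    unfolding K_def using closedin_continuous_map_preimage[OF g(1)] by (metis closed_closedin)
  then have "compactin R K"
    using royden by (simp add: royden_compactification_def closedin_compact_space)
  moreover have "K \<subseteq> \<Union> (range (\<lambda>x. {\<iota> x}))"
    using zero e by (fastforce simp: K_def royden_boundary_def)
  ultimately obtain \<F> where \<F>: "finite \<F>" "\<F> \<subseteq> range (\<lambda>x. {\<iota> x})" "K \<subseteq> \<Union>\<F>"
    using openin_royden_singleton unfolding compactin_def by (metis (no_types, lifting) imageE)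
  have "finite (\<Union>\<F>)" using \<F>(1,2) by auto
  then have "finite K" using \<F>(3) by (rule rev_finite_subset)
  moreover have "inj \<iota>"
    using royden by (auto simp: royden_compactification_def embedding_map_def
        dest: homeomorphic_imp_injective_map)
  moreover have "\<iota> ` {x. e \<le> \<bar>f x\<bar>} \<subseteq> K"
    using royden_embed_in_topspace by (auto simp: K_def g(2))
  ultimately show "finite {x. e \<le> \<bar>f x\<bar>}"
    by (meson finite_imageD inj_on_subset rev_finite_subset subset_UNIV)
qed

end

section \<open>Uniform transience and the two boundaries\<close>

theorem theorem4p2:
  fixes b :: "'a \<Rightarrow> 'a \<Rightarrow> real" and c :: "'a \<Rightarrow> real" and r :: 'a
    and R :: "'r topology" and \<iota> :: "'a \<Rightarrow> 'r"
  assumes "countable (UNIV :: 'a set)" and "infinite (UNIV :: 'a set)"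
    and "is_graph b c" and "connected_graph b"
    and "royden_compactification b c R \<iota>"
  shows "uniformly_transient b c r \<longleftrightarrow> harmonic_boundary b c r R \<iota> = royden_boundary R \<iota>"
proof
  assume "uniformly_transient b c r"
  then have "cont_extension R \<iota> f p = 0"
    if "p \<in> royden_boundary R \<iota>" "f \<in> D0 b c r \<inter> bounded_funs" for p f
    using that cont_extension_eq_0_on_royden_boundary[OF assms(5)]
    by (auto simp: uniformly_transient_def D0_def)
  then show "harmonic_boundary b c r R \<iota> = royden_boundary R \<iota>"
    by (auto simp: harmonic_boundary_def)
next
  assume eq: "harmonic_boundary b c r R \<iota> = royden_boundary R \<iota>"
  show "uniformly_transient b c r"
    unfolding uniformly_transient_def
  proof
    fix f assume "f \<in> D0 b c r"
    \<comment> \<open>\<open>f\<close> may be unbounded, whereas the harmonic boundary tests only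
      bounded functions of \<open>D0\<close>; the cut-off supplies one.\<close>
    define g where "g x = clamp1 (f x)" for x
    have g: "g \<in> D0 b c r"
      unfolding g_def by (rule D0_clamp1[OF assms(3,4)]) fact
    moreover have bdd: "g \<in> bounded_funs"
      by (auto simp: bounded_funs_def g_def clamp1_def intro!: boundedI[where B = 1])
    ultimately have "cont_extension R \<iota> g p = 0" if "p \<in> royden_boundary R \<iota>" for p
      using that eq by (auto simp: harmonic_boundary_def)
    then have "g \<in> C0_funs"
      using g bdd by (intro C0_funs_if_cont_extension_eq_0[OF assms(5)]) (auto simp: D0_def)
    show "f \<in> C0_funs"
      unfolding C0_funs_iff
    proof (intro allI impI)
      fix e :: real assume "0 < e"
      \<comment> \<open>The level is capped at 1 because the superlevel sets of \<open>f\<close> and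
        \<open>g\<close> agree only up to there.\<close>
      then have "finite {x. min e 1 \<le> \<bar>g x\<bar>}"
        using \<open>g \<in> C0_funs\<close> by (simp add: C0_funs_iff)
      moreover have "{x. e \<le> \<bar>f x\<bar>} \<subseteq> {x. min e 1 \<le> \<bar>g x\<bar>}"
      proof
        fix x assume "x \<in> {x. e \<le> \<bar>f x\<bar>}"
        then have "min e 1 \<le> \<bar>f x\<bar>" by simp
        then show "x \<in> {x. min e 1 \<le> \<bar>g x\<bar>}"
          using le_abs_clamp1_iff[of "min e 1" "f x"] by (simp only: g_def mem_Collect_eq min.cobounded2)
      qed
      ultimately show "finite {x. e \<le> \<bar>f x\<bar>}" by (rule rev_finite_subset)
    qed
  qed
qed

end
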